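(* Let $I_{t_s}\subset[0,T]$ be a compact interval with nonzero measure, containing an arbitrary time point $t_s$, and let $\Omega\subset\mathbb{R}^3$ be a simply connected and bounded domain. Let $G\in\mathbb{R}^{3\times3}$ have full rank. Assume that the coil sensitivities $R_1,R_2,R_3\in\mathbb{R}^3$ fulfill $\mathrm{span}\{R_1,R_2,R_3\}=\mathbb{R}^3$. Let $x_s:I_{t_s}\to\mathbb{R}^3$ be continuously differentiable and assume there exists an inner point $t^*\in I_{t_s}$ such that $\|\dot x_s(t^* )\|_2\neq0$. Let $l>1$ and let the operator $A_{t_s}:L^l(\Omega)\to L^2(I_{t_s})^3$ be given by $$(A_{t_s}c)(t)=\left(\int_\Omega c(x)\,s_i(x,t)\,\mathrm{d}x\right)_{i=1,2,3},\quad t\in I_{t_s},$$ with $s_i$ the magnetic particle imaging system function of the equilibrium model. Then $$\|A_{t_s}\chi_\Omega\|_{L^2(I_{t_s})^3}>0,$$ and thus $A_{t_s}\chi_\Omega\neq0$.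
   Context: $\chi_\Omega$ is the function equal to $1$ on $\Omega$. Fix constants $\mu_0,m_0,\beta>0$. The dilated Langevin function is $\mathcal{L}_\beta:\mathbb{R}\to\mathbb{R}$, $\mathcal{L}_\beta(z)=\coth(\beta z)-\frac{1}{\beta z}$ for $z\ne0$, $\mathcal{L}_\beta(0)=0$. The applied magnetic field is $H(x,t)=G(x-x_s(t))$, where $x_s$ is the trajectory of the field-free point; thus $\dot H(x,t)=-G\dot x_s(t)$. The mean magnetic moment is $$\bar m(x,t)=m_0\,\mathcal{L}_\beta(\|H(x,t)\|_2)\,\frac{H(x,t)}{\|H(x,t)\|_2}$$ (extended continuously by $0$ where $H(x,t)=0$), and the system function is $s_i(x,t)=-\mu_0R_i^T\frac{\partial\bar m(x,t)}{\partial t}$, $i=1,2,3$. Explicitly, where $H\neq 0$, $$\frac{\partial \bar m}{\partial t}=m_0\left[\left(\frac{\mathcal{L}'_\beta(\|H\|_2)}{\|H\|_2^2}-\frac{\mathcal{L}_\beta(\|H\|_2)}{\|H\|_2^3}\right)HH^T+\frac{\mathcal{L}_\beta(\|H\|_2)}{\|H\|_2}I_3\right]\dot H ,$$ with $I_3$ the $3\times3$ identity matrix. *)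

theory Defs
  imports "HOL-Analysis.Analysis"
begin

(* The Lebesgue spaces below consist of functions, not of equivalence classes: equality in
   L^p means equality almost everywhere, and "f is nonzero in L^p" is written
   "not (AE x in M. f x = 0)". *)

definition Lp_space :: "real \<Rightarrow> 'a measure \<Rightarrow> ('a \<Rightarrow> real) set" where
  "Lp_space p M = {f \<in> borel_measurable M. integrable M (\<lambda>x. \<bar>f x\<bar> powr p)}"

definition Lp_norm :: "real \<Rightarrow> 'a measure \<Rightarrow> ('a \<Rightarrow> real) \<Rightarrow> real" where
  "Lp_norm p M f = (\<integral>x. \<bar>f x\<bar> powr p \<partial>M) powr (1 / p)"

(* The product space (L^2)^3 with its Hilbert product norm. *)

definition L2_space3 :: "'a measure \<Rightarrow> ('a \<Rightarrow> real ^ 3) set" where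
  "L2_space3 M = {f. \<forall>i. (\<lambda>x. f x $ i) \<in> Lp_space 2 M}"

definition L2_norm3 :: "'a measure \<Rightarrow> ('a \<Rightarrow> real ^ 3) \<Rightarrow> real" where
  "L2_norm3 M f = norm (\<chi> i. Lp_norm 2 M (\<lambda>x. f x $ i))"

(* All time derivatives are taken within the time interval I, hence one-sided at its endpoints;
   the trajectory need not be defined outside I. *)

definition continuously_differentiable_on ::
    "(real \<Rightarrow> 'b::real_normed_vector) \<Rightarrow> real set \<Rightarrow> bool" where
  "continuously_differentiable_on f I \<longleftrightarrow>
     f differentiable_on I \<and>
     continuous_on I (\<lambda>t. vector_derivative f (at t within I))"

definition coth :: "real \<Rightarrow> real" where
  "coth z = cosh z / sinh z"

definition langevin :: "real \<Rightarrow> real \<Rightarrow> real" where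
  "langevin \<beta> z = (if z = 0 then 0 else coth (\<beta> * z) - 1 / (\<beta> * z))"

definition applied_field ::
    "real ^ 3 ^ 3 \<Rightarrow> (real \<Rightarrow> real ^ 3) \<Rightarrow> real ^ 3 \<Rightarrow> real \<Rightarrow> real ^ 3" where
  "applied_field G xs x t = G *v (x - xs t)"

definition mean_moment ::
    "real \<Rightarrow> real \<Rightarrow> real ^ 3 ^ 3 \<Rightarrow> (real \<Rightarrow> real ^ 3) \<Rightarrow> real ^ 3 \<Rightarrow> real \<Rightarrow> real ^ 3" where
  "mean_moment m0 \<beta> G xs x t =
     (let H = applied_field G xs x t
      in if H = 0 then 0 else (m0 * langevin \<beta> (norm H)) *\<^sub>R (H /\<^sub>R norm H))"

definition system_function ::
    "real \<Rightarrow> real \<Rightarrow> real \<Rightarrow> real ^ 3 ^ 3 \<Rightarrow> (3 \<Rightarrow> real ^ 3) \<Rightarrow> real set \<Rightarrow> (real \<Rightarrow> real ^ 3)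
      \<Rightarrow> 3 \<Rightarrow> real ^ 3 \<Rightarrow> real \<Rightarrow> real" where
  "system_function \<mu>0 m0 \<beta> G R I xs i x t =
     - \<mu>0 * (R i \<bullet> vector_derivative (mean_moment m0 \<beta> G xs x) (at t within I))"

definition mpi_operator ::
    "real \<Rightarrow> real \<Rightarrow> real \<Rightarrow> real ^ 3 ^ 3 \<Rightarrow> (3 \<Rightarrow> real ^ 3) \<Rightarrow> real set \<Rightarrow> (real \<Rightarrow> real ^ 3)
      \<Rightarrow> (real ^ 3) set \<Rightarrow> (real ^ 3 \<Rightarrow> real) \<Rightarrow> real \<Rightarrow> real ^ 3" where
  "mpi_operator \<mu>0 m0 \<beta> G R I xs \<Omega> c t =
     (\<chi> i. \<integral>x. c x * system_function \<mu>0 m0 \<beta> G R I xs i x t \<partial>lebesgue_on \<Omega>)"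

end

theory Submission
  imports Defs
begin

text \<open>
  Write \<open>F y = m0 L(\<bar>y\<bar>) y / \<bar>y\<bar>\<close> for the magnetization of the particles in a field \<open>y\<close>, with \<open>L\<close>
  the dilated Langevin function. The mean moment is \<open>F (G (x - xs t))\<close>, so by the chain rule its
  time derivative is \<open>- DF (G (x - xs t)) (G v)\<close> with \<open>v\<close> the velocity of the field-free point.

  The core of the argument is that \<open>DF y\<close> is positive definite. It acts on the line through
  \<open>y\<close> as multiplication by \<open>m0 L'(\<bar>y\<bar>)\<close> and on the orthogonal complement as multiplication by
  \<open>m0 L(\<bar>y\<bar>) / \<bar>y\<bar>\<close>, and both numbers are positive because \<open>z < sinh z < z cosh z\<close> for
  \<open>z > 0\<close> (\<open>susceptibility_pos\<close>). Hence, at a time when \<open>w = G v\<close> is nonzero, the integrand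
  \<open>w \<bullet> DF (G (x - xs t)) w\<close> is positive at almost every \<open>x \<in> \<Omega>\<close>; there is no
  cancellation, and the vector \<open>\<integral>\<^sub>\<Omega> DF (G (x - xs t)) w dx\<close> is nonzero
  (\<open>response_indicator_nonzero\<close>). The coils measure its inner products with a spanning set of
  vectors, so at least one coil sees a nonzero signal at that time.

  To pass from one time to the \<open>L\<^sup>2\<close> norm, the signal is shown to be continuous in time
  (\<open>continuous_on_response\<close>), by dominated convergence: the two eigenvalues above are at most
  \<open>m0 \<beta>\<close>, which bounds \<open>DF\<close>. The same two facts show that the operator is well defined and maps
  into \<open>L\<^sup>2\<close>. The explicit formula for \<open>DF\<close> holds at nonzero fields, and this suffices: the
  field vanishes only at \<open>x = xs t\<close>, and for every fixed \<open>t\<close> this point is a null set.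
\<close>

section \<open>The Langevin function\<close>

lemma sinh_gt_self:
  fixes z :: real
  assumes "z > 0"
  shows "z < sinh z"
proof -
  have "(\<lambda>u::real. sinh u - u) 0 < (\<lambda>u. sinh u - u) z"
  proof (rule DERIV_pos_imp_increasing_open[OF assms])
    fix u :: real assume "0 < u"
    then have "cosh u - 1 > 0"
      using cosh_real_strict_mono[of 0 u] by simp
    moreover have "((\<lambda>u::real. sinh u - u) has_real_derivative (cosh u - 1)) (at u)"
      by (auto intro!: derivative_eq_intros)
    ultimately show "\<exists>y. ((\<lambda>u::real. sinh u - u) has_real_derivative y) (at u) \<and> 0 < y"
      by blast
  qed (auto intro!: continuous_intros)
  then show ?thesis by simp
qed

lemma sinh_less_mult_cosh:
  fixes z :: real
  assumes "z > 0"
  shows "sinh z < z * cosh z"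
proof -
  have "(\<lambda>u::real. u * cosh u - sinh u) 0 < (\<lambda>u. u * cosh u - sinh u) z"
  proof (rule DERIV_pos_imp_increasing_open[OF assms])
    fix u :: real assume "0 < u"
    then have "u * sinh u > 0" by simp
    moreover have "((\<lambda>u::real. u * cosh u - sinh u) has_real_derivative (u * sinh u)) (at u)"
      by (auto intro!: derivative_eq_intros)
    ultimately show "\<exists>y. ((\<lambda>u::real. u * cosh u - sinh u) has_real_derivative y) (at u) \<and> 0 < y"
      by blast
  qed (auto intro!: continuous_intros)
  then show ?thesis by simp
qed

text \<open>
  This is \<open>coth z - 1 / z \<le> z\<close> with denominators cleared. The difference of the two sides vanishes
  at \<open>0\<close> and has derivative \<open>z sinh z + z\<^sup>2 cosh z\<close>.
\<close>

lemma mult_cosh_le: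
  fixes z :: real
  assumes "z > 0"
  shows "z * cosh z \<le> (1 + z\<^sup>2) * sinh z"
proof -
  have "z * cosh z - sinh z \<le> z\<^sup>2 * sinh z"
  proof -
    have "(\<lambda>u::real. u\<^sup>2 * sinh u + sinh u - u * cosh u) 0
        < (\<lambda>u. u\<^sup>2 * sinh u + sinh u - u * cosh u) z"
    proof (rule DERIV_pos_imp_increasing_open[OF assms])
      fix u :: real assume "0 < u"
      then have "u * sinh u + u\<^sup>2 * cosh u > 0" by (simp add: add_pos_pos)
      moreover have "((\<lambda>u::real. u\<^sup>2 * sinh u + sinh u - u * cosh u) has_real_derivative
          (u * sinh u + u\<^sup>2 * cosh u)) (at u)"
        by (auto intro!: derivative_eq_intros simp: power2_eq_square algebra_simps)
      ultimately show "\<exists>y. ((\<lambda>u::real. u\<^sup>2 * sinh u + sinh u - u * cosh u)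
          has_real_derivative y) (at u) \<and> 0 < y"
        by blast
    qed (auto intro!: continuous_intros)
    then show ?thesis by simp
  qed
  then show ?thesis by (simp add: algebra_simps)
qed

definition langevin_slope :: "real \<Rightarrow> real \<Rightarrow> real" where
  "langevin_slope \<beta> z = \<beta> * (1 / (\<beta> * z)\<^sup>2 - 1 / (sinh (\<beta> * z))\<^sup>2)"

lemma has_real_derivative_langevin:
  assumes "\<beta> > 0" "z > 0"
  shows "(langevin \<beta> has_real_derivative langevin_slope \<beta> z) (at z)"
proof -
  have pos: "\<beta> * z > 0" using assms by simp
  have cs: "(cosh (\<beta> * z))\<^sup>2 = 1 + (sinh (\<beta> * z))\<^sup>2"
    using cosh_square_eq[of "\<beta> * z"] by simp
  have "((\<lambda>z. cosh (\<beta> * z) / sinh (\<beta> * z) - 1 / (\<beta> * z)) has_real_derivative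
      (\<beta> * (sinh (\<beta> * z))\<^sup>2 - \<beta> * (cosh (\<beta> * z))\<^sup>2) / (sinh (\<beta> * z))\<^sup>2 + \<beta> / (\<beta> * z)\<^sup>2) (at z)"
    using assms pos
    by (auto intro!: derivative_eq_intros simp: power2_eq_square algebra_simps)
  moreover have "(\<beta> * (sinh (\<beta> * z))\<^sup>2 - \<beta> * (cosh (\<beta> * z))\<^sup>2) / (sinh (\<beta> * z))\<^sup>2
      + \<beta> / (\<beta> * z)\<^sup>2 = langevin_slope \<beta> z"
    unfolding langevin_slope_def cs by (simp add: algebra_simps)
  ultimately have "((\<lambda>z. cosh (\<beta> * z) / sinh (\<beta> * z) - 1 / (\<beta> * z)) has_real_derivative
      langevin_slope \<beta> z) (at z)" by simp
  then show ?thesis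
    by (rule DERIV_cong_ev[THEN iffD1, OF refl _ refl, rotated])
       (use eventually_nhds_in_open[of "{0<..}" z] assms in
         \<open>auto elim!: eventually_mono simp: langevin_def coth_def\<close>)
qed

text \<open>
  With \<open>v = \<beta> z\<close>, the lower bound is \<open>v < sinh v\<close>. The upper bound is \<open>sinh v \<le> v cosh v\<close>
  squared, after replacing \<open>cosh\<^sup>2\<close> by \<open>1 + sinh\<^sup>2\<close>.
\<close>

lemma langevin_slope_bounds:
  assumes "\<beta> > 0" "z > 0"
  shows "0 < langevin_slope \<beta> z" "langevin_slope \<beta> z \<le> \<beta>"
proof -
  define v where "v = \<beta> * z"
  have v: "v > 0" using assms by (simp add: v_def)
  have s: "sinh v > 0" using v by simp
  have "v\<^sup>2 < (sinh v)\<^sup>2"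
    using sinh_gt_self[OF v] v by (intro power_strict_mono) auto
  then have "1 / (sinh v)\<^sup>2 < 1 / v\<^sup>2"
    using v s by (intro divide_strict_left_mono) auto
  then show "0 < langevin_slope \<beta> z"
    using assms by (simp add: langevin_slope_def v_def)
  have "(sinh v)\<^sup>2 \<le> (v * cosh v)\<^sup>2"
    using sinh_less_mult_cosh[OF v] s by (intro power_mono) auto
  also have "\<dots> = v\<^sup>2 * ((sinh v)\<^sup>2 + 1)"
    by (simp add: power_mult_distrib cosh_square_eq)
  finally have "1 / v\<^sup>2 - 1 / (sinh v)\<^sup>2 \<le> 1"
    using v s by (simp add: field_simps)
  then show "langevin_slope \<beta> z \<le> \<beta>"
    using assms by (simp add: langevin_slope_def v_def)
qed

lemma langevin_quotient_bounds:
  assumes "\<beta> > 0" "z > 0"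
  shows "0 < langevin \<beta> z / z" "langevin \<beta> z / z \<le> \<beta>"
proof -
  define v where "v = \<beta> * z"
  have v: "v > 0" using assms by (simp add: v_def)
  have s: "sinh v > 0" using v by simp
  have L: "langevin \<beta> z = (v * cosh v - sinh v) / (v * sinh v)"
    using assms v s by (simp add: langevin_def coth_def v_def field_simps)
  show "0 < langevin \<beta> z / z"
    unfolding L using sinh_less_mult_cosh[OF v] v s assms by simp
  have "langevin \<beta> z \<le> v"
    unfolding L using mult_cosh_le[OF v] v s
    by (simp add: divide_le_eq power2_eq_square algebra_simps)
  then show "langevin \<beta> z / z \<le> \<beta>"
    using assms by (simp add: v_def divide_le_eq)
qed

section \<open>The magnetization and its derivative\<close>

text \<open>
  At \<open>y = 0\<close> the right-hand side is \<open>0\<close>, which is the continuous extension.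
\<close>

definition magnetization :: "real \<Rightarrow> real \<Rightarrow> 'a::real_inner \<Rightarrow> 'a" where
  "magnetization m0 \<beta> y = (m0 * langevin \<beta> (norm y)) *\<^sub>R (y /\<^sub>R norm y)"

text \<open>
  The derivative of the magnetization at \<open>y \<noteq> 0\<close> in direction \<open>w\<close>: \<open>m0\<close> times the
  matrix \<open>(L'/\<bar>y\<bar>\<^sup>2 - L/\<bar>y\<bar>\<^sup>3) y y\<^sup>T + (L/\<bar>y\<bar>) I\<close> applied to \<open>w\<close>, which physics calls the
  differential susceptibility.
\<close>

definition susceptibility :: "real \<Rightarrow> real \<Rightarrow> 'a::real_inner \<Rightarrow> 'a \<Rightarrow> 'a" where
  "susceptibility m0 \<beta> y w =
     m0 *\<^sub>R (((langevin_slope \<beta> (norm y) - langevin \<beta> (norm y) / norm y) * (y \<bullet> w) / (norm y)\<^sup>2) *\<^sub>R y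
       + (langevin \<beta> (norm y) / norm y) *\<^sub>R w)"

text \<open>
  The product rule for \<open>(L(\<bar>H\<bar>) / \<bar>H\<bar>) H\<close>. It is stated along a curve and within a set so that it
  applies directly to one-sided time derivatives.
\<close>

lemma has_vector_derivative_magnetization:
  fixes H :: "real \<Rightarrow> 'a::real_inner"
  assumes \<beta>: "\<beta> > 0" and H: "(H has_vector_derivative w) (at t within S)" and nz: "H t \<noteq> 0"
  shows "((\<lambda>s. magnetization m0 \<beta> (H s)) has_vector_derivative susceptibility m0 \<beta> (H t) w)
    (at t within S)"
proof -
  let ?h = "norm (H t)"
  have h: "?h > 0" using nz by simp
  have N: "((\<lambda>s. norm (H s)) has_real_derivative (H t \<bullet> w) / ?h) (at t within S)"
    using has_derivative_compose[OF H[unfolded has_vector_derivative_def] has_derivative_norm[OF nz]]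
    unfolding has_field_derivative_def
    by (rule has_derivative_eq_rhs)
       (auto simp: fun_eq_iff sgn_div_norm inner_commute field_simps)
  have L: "((\<lambda>s. langevin \<beta> (norm (H s))) has_real_derivative
      langevin_slope \<beta> ?h * ((H t \<bullet> w) / ?h)) (at t within S)"
    using DERIV_chain2[OF has_real_derivative_langevin[OF \<beta> h] N] .
  have Q: "((\<lambda>s. langevin \<beta> (norm (H s)) / norm (H s)) has_real_derivative
      (langevin_slope \<beta> ?h * ((H t \<bullet> w) / ?h) * ?h - langevin \<beta> ?h * ((H t \<bullet> w) / ?h)) / (?h * ?h))
      (at t within S)"
    using DERIV_divide[OF L N] h by simp
  have "((\<lambda>s. (langevin \<beta> (norm (H s)) / norm (H s)) *\<^sub>R H s) has_vector_derivative
      (langevin \<beta> ?h / ?h) *\<^sub>R w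
      + ((langevin_slope \<beta> ?h * ((H t \<bullet> w) / ?h) * ?h - langevin \<beta> ?h * ((H t \<bullet> w) / ?h)) / (?h * ?h)) *\<^sub>R H t)
      (at t within S)"
    by (rule has_vector_derivative_scaleR[OF Q H])
  then have "((\<lambda>s. m0 *\<^sub>R ((langevin \<beta> (norm (H s)) / norm (H s)) *\<^sub>R H s)) has_vector_derivative
      m0 *\<^sub>R ((langevin \<beta> ?h / ?h) *\<^sub>R w
      + ((langevin_slope \<beta> ?h * ((H t \<bullet> w) / ?h) * ?h - langevin \<beta> ?h * ((H t \<bullet> w) / ?h)) / (?h * ?h)) *\<^sub>R H t))
      (at t within S)"
    by (rule bounded_linear.has_vector_derivative[OF bounded_linear_scaleR_right])
  moreover have "(\<lambda>s. m0 *\<^sub>R ((langevin \<beta> (norm (H s)) / norm (H s)) *\<^sub>R H s))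
      = (\<lambda>s. magnetization m0 \<beta> (H s))"
    by (simp add: magnetization_def fun_eq_iff divide_inverse mult_ac)
  moreover have "(langevin_slope \<beta> ?h * ((H t \<bullet> w) / ?h) * ?h - langevin \<beta> ?h * ((H t \<bullet> w) / ?h)) / (?h * ?h)
      = (langevin_slope \<beta> ?h - langevin \<beta> ?h / ?h) * (H t \<bullet> w) / ?h\<^sup>2"
    using h by (simp add: field_simps power2_eq_square)
  ultimately show ?thesis
    unfolding susceptibility_def by (simp add: add.commute)
qed

text \<open>
  Let \<open>p\<close> be the squared length of the projection of \<open>w\<close> to the line through \<open>y\<close>. The quadratic
  form equals \<open>m0 (L' p + (L/\<bar>y\<bar>) (\<bar>w\<bar>\<^sup>2 - p))\<close>, where \<open>0 \<le> p \<le> \<bar>w\<bar>\<^sup>2\<close> by Cauchy-Schwarz and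
  both coefficients are positive.
\<close>

lemma susceptibility_pos:
  assumes "m0 > 0" "\<beta> > 0" "y \<noteq> 0" "w \<noteq> 0"
  shows "w \<bullet> susceptibility m0 \<beta> y w > 0"
proof -
  let ?a = "langevin_slope \<beta> (norm y)" and ?b = "langevin \<beta> (norm y) / norm y"
  have y: "norm y > 0" using assms by simp
  have a: "?a > 0" and b: "?b > 0"
    using langevin_slope_bounds[OF assms(2) y] langevin_quotient_bounds[OF assms(2) y] by auto
  let ?p = "(y \<bullet> w)\<^sup>2 / (norm y)\<^sup>2" and ?n = "(norm w)\<^sup>2"
  have p0: "0 \<le> ?p" by simp
  have "(y \<bullet> w)\<^sup>2 \<le> (norm y)\<^sup>2 * (norm w)\<^sup>2"
    using Cauchy_Schwarz_ineq[of y w] by (simp add: power2_norm_eq_inner)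
  then have pn: "?p \<le> ?n" using y by (simp add: divide_le_eq mult.commute)
  have n: "?n > 0" using assms by simp
  have "0 < ?a * ?p + ?b * (?n - ?p)"
  proof (cases "?p = 0")
    case True then show ?thesis unfolding True using b n by (metis add_0 diff_zero mult_pos_pos mult_zero_right)
  next
    case False
    then have "?a * ?p > 0" using a p0 by (simp add: less_le)
    moreover have "?b * (?n - ?p) \<ge> 0"
      using b pn by (intro mult_nonneg_nonneg) linarith+
    ultimately show ?thesis by linarith
  qed
  moreover have "w \<bullet> susceptibility m0 \<beta> y w = m0 * (?a * ?p + ?b * (?n - ?p))"
    unfolding susceptibility_def
    by (simp add: inner_add_right inner_commute[of w y] power2_norm_eq_inner[of w]
        power2_eq_square[of "y \<bullet> w"] diff_divide_distrib algebra_simps)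
  ultimately show ?thesis using assms(1) by simp
qed

text \<open>
  A crude bound, obtained from the triangle inequality, that serves as the dominating constant; what
  matters is that it is uniform in \<open>y\<close>, so that it holds arbitrarily close to the field-free point.
\<close>

lemma norm_susceptibility_le:
  assumes "m0 > 0" "\<beta> > 0" "y \<noteq> 0"
  shows "norm (susceptibility m0 \<beta> y w) \<le> 2 * m0 * \<beta> * norm w"
proof -
  let ?a = "langevin_slope \<beta> (norm y)" and ?b = "langevin \<beta> (norm y) / norm y"
  have y: "norm y > 0" using assms by simp
  have ab: "\<bar>?a - ?b\<bar> \<le> \<beta>" and b: "\<bar>?b\<bar> \<le> \<beta>"
    using langevin_slope_bounds[OF assms(2) y] langevin_quotient_bounds[OF assms(2) y] by auto
  have "norm (((?a - ?b) * (y \<bullet> w) / (norm y)\<^sup>2) *\<^sub>R y) = \<bar>?a - ?b\<bar> * (\<bar>y \<bullet> w\<bar> / norm y)"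
    using y by (simp add: abs_mult power2_eq_square)
  also have "\<dots> \<le> \<beta> * norm w"
    using ab Cauchy_Schwarz_ineq2[of y w] y assms(2)
    by (intro mult_mono) (auto simp: divide_le_eq mult.commute)
  finally have 1: "norm (((?a - ?b) * (y \<bullet> w) / (norm y)\<^sup>2) *\<^sub>R y) \<le> \<beta> * norm w" .
  have 2: "norm (?b *\<^sub>R w) \<le> \<beta> * norm w"
    unfolding norm_scaleR using b by (intro mult_right_mono) auto
  have "norm (susceptibility m0 \<beta> y w) \<le> m0 * (\<beta> * norm w + \<beta> * norm w)"
    unfolding susceptibility_def norm_scaleR using assms(1)
    by (intro mult_mono order_trans[OF norm_triangle_ineq add_mono[OF 1 2]]) auto
  then show ?thesis by (simp add: algebra_simps)
qed

lemma tendsto_susceptibility: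
  assumes \<beta>: "\<beta> > 0" and f: "(f \<longlongrightarrow> y) F" and g: "(g \<longlongrightarrow> w) F" and y: "y \<noteq> 0"
  shows "((\<lambda>x. susceptibility m0 \<beta> (f x) (g x)) \<longlongrightarrow> susceptibility m0 \<beta> y w) F"
proof -
  have n: "norm y > 0" using y by simp
  have "isCont (langevin_slope \<beta>) (norm y)"
    unfolding langevin_slope_def using \<beta> n by (intro continuous_intros) auto
  then have 1: "((\<lambda>x. langevin_slope \<beta> (norm (f x))) \<longlongrightarrow> langevin_slope \<beta> (norm y)) F"
    by (rule isCont_tendsto_compose) (intro tendsto_norm f)
  have 2: "((\<lambda>x. langevin \<beta> (norm (f x))) \<longlongrightarrow> langevin \<beta> (norm y)) F"
    using DERIV_isCont[OF has_real_derivative_langevin[OF \<beta> n]]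
    by (rule isCont_tendsto_compose) (intro tendsto_norm f)
  show ?thesis
    unfolding susceptibility_def using y by (intro tendsto_intros 1 2 f g) auto
qed


section \<open>Null sets\<close>

lemma AE_lebesgue_on_neq:
  fixes p :: "'a::euclidean_space"
  assumes "S \<in> sets lebesgue"
  shows "AE x in lebesgue_on S. x \<noteq> p"
proof -
  have "AE x in lebesgue. x \<noteq> p"
    by (rule AE_completion[OF AE_lborel_singleton])
  then show ?thesis
    using assms by (auto simp: AE_restrict_space_iff elim: eventually_mono)
qed

text \<open>
  The points of the interior where \<open>f\<close> does not vanish form an open set. If it is null, it is empty.
\<close>

lemma continuous_AE_zero_on_interior:
  fixes f :: "'a::euclidean_space \<Rightarrow> 'b::real_normed_vector"
  assumes f: "continuous_on S f" and S: "S \<in> sets lebesgue"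
    and ae: "AE x in lebesgue_on S. f x = 0" and x0: "x0 \<in> interior S"
  shows "f x0 = 0"
proof (rule ccontr)
  assume nz: "f x0 \<noteq> 0"
  let ?U = "interior S \<inter> f -` (- {0})"
  have "continuous_on (interior S) f"
    using f interior_subset continuous_on_subset by blast
  then have opn: "open ?U"
    by (intro continuous_open_preimage) auto
  have "AE x in lebesgue. x \<in> S \<longrightarrow> f x = 0"
    using ae S by (simp add: AE_restrict_space_iff)
  then have "AE x in lebesgue. x \<notin> ?U"
    by (rule eventually_mono) (use interior_subset in auto)
  then have "negligible ?U"
    using opn by (simp add: negligible_iff_null_sets AE_iff_null_sets)
  moreover have "?U \<noteq> {}" using x0 nz by auto
  ultimately show False
    using open_not_negligible[OF opn] by blast
qed

section \<open>The response integrated over the domain\<close>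

text \<open>
  The response of a particle concentration \<open>c\<close> on \<open>\<Omega>\<close> when the field-free point is at \<open>p\<close> and the
  applied field changes with velocity \<open>- w\<close>. All coils measure inner products with this one vector.
\<close>

definition response ::
    "real \<Rightarrow> real \<Rightarrow> real ^ 'n ^ 'n \<Rightarrow> (real ^ 'n) set \<Rightarrow> (real ^ 'n \<Rightarrow> real) \<Rightarrow> real ^ 'n \<Rightarrow> real ^ 'n
      \<Rightarrow> real ^ 'n" where
  "response m0 \<beta> G \<Omega> c p w =
     (\<integral>x. c x *\<^sub>R susceptibility m0 \<beta> (G *v (x - p)) w \<partial>lebesgue_on \<Omega>)"

lemma inj_matrix_vector_mult_diff_nonzero:
  fixes G :: "real ^ 'n ^ 'm"
  assumes "inj ((*v) G)" "x \<noteq> p"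
  shows "G *v (x - p) \<noteq> 0"
  using assms by (metis eq_iff_diff_eq_0 injD matrix_vector_mult_0_right)

lemma AE_norm_response_integrand_le:
  fixes G :: "real ^ 'n ^ 'n"
  assumes "m0 > 0" "\<beta> > 0" "inj ((*v) G)" "\<Omega> \<in> sets lebesgue" "norm w \<le> B"
  shows "AE x in lebesgue_on \<Omega>.
    norm (c x *\<^sub>R susceptibility m0 \<beta> (G *v (x - p)) w) \<le> 2 * m0 * \<beta> * B * \<bar>c x\<bar>"
  using AE_lebesgue_on_neq[OF assms(4), of p]
proof (rule eventually_mono)
  fix x assume "x \<noteq> p"
  then have "G *v (x - p) \<noteq> 0"
    by (rule inj_matrix_vector_mult_diff_nonzero[OF assms(3)])
  from norm_susceptibility_le[OF assms(1,2) this, of w]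
  have "norm (susceptibility m0 \<beta> (G *v (x - p)) w) \<le> 2 * m0 * \<beta> * B"
    by (rule order_trans) (use assms in \<open>auto intro: mult_left_mono\<close>)
  from mult_left_mono[OF this, of "\<bar>c x\<bar>"]
  show "norm (c x *\<^sub>R susceptibility m0 \<beta> (G *v (x - p)) w) \<le> 2 * m0 * \<beta> * B * \<bar>c x\<bar>"
    by (simp add: mult.commute)
qed

text \<open>
  As a function of position the susceptibility is continuous away from the field-free point; a single
  exceptional point does not affect Borel measurability.
\<close>

lemma borel_measurable_susceptibility:
  fixes G :: "real ^ 'n ^ 'n"
  assumes "\<beta> > 0" "inj ((*v) G)"
  shows "(\<lambda>x. susceptibility m0 \<beta> (G *v (x - p)) w) \<in> borel_measurable (lebesgue_on \<Omega>)"
proof -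
  have "continuous_on (- {p}) (\<lambda>x. susceptibility m0 \<beta> (G *v (x - p)) w)"
    unfolding continuous_on_def
  proof
    fix x assume "x \<in> - {p}"
    then have "G *v (x - p) \<noteq> 0"
      using inj_matrix_vector_mult_diff_nonzero[OF assms(2), of x p] by simp
    then show "((\<lambda>x. susceptibility m0 \<beta> (G *v (x - p)) w) \<longlongrightarrow> susceptibility m0 \<beta> (G *v (x - p)) w)
        (at x within - {p})"
      by (intro tendsto_susceptibility assms(1)
          bounded_linear.tendsto[OF matrix_vector_mul_bounded_linear] tendsto_intros)
  qed
  then have "(\<lambda>x. susceptibility m0 \<beta> (G *v (x - p)) w) \<in> borel_measurable borel"
    by (intro borel_measurable_continuous_countable_exceptions[of "{p}"]) auto
  then show ?thesis
    by (intro measurable_restrict_space1 measurable_completion) auto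
qed

lemma integrable_response:
  fixes G :: "real ^ 'n ^ 'n"
  assumes "m0 > 0" "\<beta> > 0" "inj ((*v) G)" "\<Omega> \<in> sets lebesgue" "integrable (lebesgue_on \<Omega>) c"
  shows "integrable (lebesgue_on \<Omega>) (\<lambda>x. c x *\<^sub>R susceptibility m0 \<beta> (G *v (x - p)) w)"
proof (rule Bochner_Integration.integrable_bound)
  show "integrable (lebesgue_on \<Omega>) (\<lambda>x. 2 * m0 * \<beta> * norm w * \<bar>c x\<bar>)"
    using assms(5) by auto
  show "(\<lambda>x. c x *\<^sub>R susceptibility m0 \<beta> (G *v (x - p)) w) \<in> borel_measurable (lebesgue_on \<Omega>)"
    using borel_measurable_susceptibility[OF assms(2,3)] assms(5) by (intro borel_measurable_scaleR) auto
  show "AE x in lebesgue_on \<Omega>. norm (c x *\<^sub>R susceptibility m0 \<beta> (G *v (x - p)) w)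
      \<le> norm (2 * m0 * \<beta> * norm w * \<bar>c x\<bar>)"
    using AE_norm_response_integrand_le[OF assms(1-4) order_refl] assms(1,2)
    by (simp add: abs_mult)
qed

text \<open>
  Dominated convergence along a sequence of times. For the limit time \<open>t\<close> the integrand converges at
  every \<open>x \<noteq> p t\<close>; the dominating function is a multiple of \<open>\<bar>c\<bar>\<close> because \<open>w\<close> is bounded on the
  compact set \<open>S\<close>.
\<close>

lemma continuous_on_response:
  fixes G :: "real ^ 'n ^ 'n" and p w :: "real \<Rightarrow> real ^ 'n"
  assumes "m0 > 0" "\<beta> > 0" and G: "inj ((*v) G)" and \<Omega>: "\<Omega> \<in> sets lebesgue"
    and c: "integrable (lebesgue_on \<Omega>) c"
    and S: "compact S" and p: "continuous_on S p" and w: "continuous_on S w"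
  shows "continuous_on S (\<lambda>t. response m0 \<beta> G \<Omega> c (p t) (w t))"
proof (rule continuous_on_sequentiallyI)
  fix u :: "nat \<Rightarrow> real" and t
  assume u: "\<forall>n. u n \<in> S" "t \<in> S" "u \<longlonglongrightarrow> t"
  have pu: "(\<lambda>n. p (u n)) \<longlonglongrightarrow> p t" and wu: "(\<lambda>n. w (u n)) \<longlonglongrightarrow> w t"
    using continuous_on_tendsto_compose[OF p u(3) u(2)]
      continuous_on_tendsto_compose[OF w u(3) u(2)] u(1) by auto
  have "bounded (w ` S)"
    using compact_continuous_image[OF w S] by (rule compact_imp_bounded)
  then obtain B where B: "\<And>s. s \<in> S \<Longrightarrow> norm (w s) \<le> B"
    by (auto simp: bounded_iff)
  show "(\<lambda>n. response m0 \<beta> G \<Omega> c (p (u n)) (w (u n))) \<longlonglongrightarrow> response m0 \<beta> G \<Omega> c (p t) (w t)"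
    unfolding response_def
  proof (rule integral_dominated_convergence[where w = "\<lambda>x. 2 * m0 * \<beta> * B * \<bar>c x\<bar>"])
    show "integrable (lebesgue_on \<Omega>) (\<lambda>x. 2 * m0 * \<beta> * B * \<bar>c x\<bar>)"
      using c by auto
    show "AE x in lebesgue_on \<Omega>.
        (\<lambda>n. c x *\<^sub>R susceptibility m0 \<beta> (G *v (x - p (u n))) (w (u n)))
          \<longlonglongrightarrow> c x *\<^sub>R susceptibility m0 \<beta> (G *v (x - p t)) (w t)"
      using AE_lebesgue_on_neq[OF \<Omega>, of "p t"]
    proof (rule eventually_mono)
      fix x assume "x \<noteq> p t"
      then have "G *v (x - p t) \<noteq> 0"
        using inj_matrix_vector_mult_diff_nonzero[OF G] by blast
      then show "(\<lambda>n. c x *\<^sub>R susceptibility m0 \<beta> (G *v (x - p (u n))) (w (u n)))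
          \<longlonglongrightarrow> c x *\<^sub>R susceptibility m0 \<beta> (G *v (x - p t)) (w t)"
        by (intro tendsto_scaleR tendsto_susceptibility tendsto_const assms(2) wu
            bounded_linear.tendsto[OF matrix_vector_mul_bounded_linear] tendsto_diff pu)
    qed
    show "AE x in lebesgue_on \<Omega>.
        norm (c x *\<^sub>R susceptibility m0 \<beta> (G *v (x - p (u n))) (w (u n))) \<le> 2 * m0 * \<beta> * B * \<bar>c x\<bar>"
      for n
      using u(1) B by (intro AE_norm_response_integrand_le assms) auto
  qed (use integrable_response[OF assms(1-5)] in auto)
qed

text \<open>
  The inner product of the response with \<open>w\<close> is the integral of a function that is positive almost
  everywhere on \<open>\<Omega>\<close>, and \<open>\<Omega>\<close> is not null.
\<close>

lemma response_indicator_nonzero: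
  fixes G :: "real ^ 'n ^ 'n"
  assumes "m0 > 0" "\<beta> > 0" and G: "inj ((*v) G)" and \<Omega>: "open \<Omega>" "bounded \<Omega>" "\<Omega> \<noteq> {}"
    and w: "w \<noteq> 0"
  shows "response m0 \<beta> G \<Omega> (indicator \<Omega>) p w \<noteq> 0"
proof
  assume zero: "response m0 \<beta> G \<Omega> (indicator \<Omega>) p w = 0"
  have lm: "\<Omega> \<in> lmeasurable" using \<Omega> lmeasurable_open by blast
  then have ms: "\<Omega> \<in> sets lebesgue" by auto
  interpret finite_measure "lebesgue_on \<Omega>" by (rule finite_measure_lebesgue_on[OF lm])
  have one: "integrable (lebesgue_on \<Omega>) (indicator \<Omega> :: _ \<Rightarrow> real)"
    using integrable_const[of "1::real"]
    by (rule Bochner_Integration.integrable_cong[THEN iffD1, rotated -1]) auto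
  let ?f = "\<lambda>x. indicator \<Omega> x *\<^sub>R susceptibility m0 \<beta> (G *v (x - p)) w"
  note int = integrable_response[OF assms(1,2) G ms one, of p w]
  have pos: "AE x in lebesgue_on \<Omega>. w \<bullet> ?f x > 0"
    using AE_lebesgue_on_neq[OF ms, of p] AE_space[of "lebesgue_on \<Omega>"]
  proof eventually_elim
    case (elim x)
    then have "G *v (x - p) \<noteq> 0"
      using inj_matrix_vector_mult_diff_nonzero[OF G] by blast
    then show ?case
      using susceptibility_pos[OF assms(1,2) _ w, of "G *v (x - p)"] elim by simp
  qed
  have "(\<integral>x. w \<bullet> ?f x \<partial>lebesgue_on \<Omega>) = w \<bullet> response m0 \<beta> G \<Omega> (indicator \<Omega>) p w"
    unfolding response_def by (rule integral_inner_right) (use int in auto)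
  then have "(\<integral>x. w \<bullet> ?f x \<partial>lebesgue_on \<Omega>) = 0"
    using zero by (simp del: inner_scaleR_right)
  moreover have "integrable (lebesgue_on \<Omega>) (\<lambda>x. w \<bullet> ?f x)"
    by (rule integrable_inner_right) (use int in auto)
  moreover have "AE x in lebesgue_on \<Omega>. 0 \<le> w \<bullet> ?f x"
    using pos by (rule eventually_mono) (rule less_imp_le)
  ultimately have "AE x in lebesgue_on \<Omega>. w \<bullet> ?f x = 0"
    using integral_nonneg_eq_0_iff_AE by blast
  with pos have "AE x in lebesgue_on \<Omega>. False"
    by eventually_elim linarith
  then have "AE x in lebesgue. x \<notin> \<Omega>"
    using ms by (simp add: AE_restrict_space_iff)
  then have "negligible \<Omega>"
    using ms by (simp add: negligible_iff_null_sets AE_iff_null_sets)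
  then show False
    using open_not_negligible \<Omega> by blast
qed

section \<open>Lebesgue spaces\<close>

text \<open>
  On a finite measure space \<open>L\<^sup>l\<close> is contained in \<open>L\<^sup>1\<close>, since \<open>\<bar>c\<bar> \<le> 1 + \<bar>c\<bar>\<^sup>l\<close>.
\<close>

lemma integrable_Lp_space:
  assumes "finite_measure M" "l \<ge> 1" "c \<in> Lp_space l M"
  shows "integrable M c"
proof (rule Bochner_Integration.integrable_bound)
  interpret finite_measure M by fact
  show "integrable M (\<lambda>x. 1 + \<bar>c x\<bar> powr l)"
    using assms(3) by (auto simp: Lp_space_def)
  show "c \<in> borel_measurable M" using assms(3) by (auto simp: Lp_space_def)
  show "AE x in M. norm (c x) \<le> norm (1 + \<bar>c x\<bar> powr l)"
  proof (rule AE_I2)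
    fix x
    show "norm (c x) \<le> norm (1 + \<bar>c x\<bar> powr l)"
    proof (cases "\<bar>c x\<bar> \<le> 1")
      case False
      then have "\<bar>c x\<bar> powr 1 \<le> \<bar>c x\<bar> powr l" using assms(2) by (intro powr_mono) auto
      then show ?thesis using False by simp
    qed (simp add: add_increasing2)
  qed
qed

lemma continuous_on_imp_L2_space3:
  fixes f :: "real \<Rightarrow> real ^ 3"
  assumes "continuous_on {a..b} f"
  shows "f \<in> L2_space3 (lebesgue_on {a..b})"
proof -
  have c: "continuous_on {a..b} (\<lambda>x. f x $ i)" for i
    using assms by (intro continuous_intros)
  have "continuous_on {a..b} (\<lambda>x. \<bar>f x $ i\<bar> powr 2)" for i
    using c[of i] by (simp add: powr_numeral continuous_intros)
  then show ?thesis
    using c unfolding L2_space3_def Lp_space_def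
    by (auto intro!: continuous_imp_measurable_on_sets_lebesgue continuous_imp_integrable_real)
qed

lemma L2_norm3_pos:
  assumes f: "f \<in> L2_space3 M" and nz: "\<not> (AE x in M. f x = 0)"
  shows "L2_norm3 M f > 0"
proof -
  have "\<exists>i. \<not> (AE x in M. f x $ i = 0)"
  proof (rule ccontr)
    assume "\<not> ?thesis"
    then have "AE x in M. \<forall>i. f x $ i = 0"
      by (intro eventually_all_finite) auto
    then show False
      using nz by (simp add: vec_eq_iff)
  qed
  then obtain i where i: "\<not> (AE x in M. f x $ i = 0)" by blast
  have "integrable M (\<lambda>x. \<bar>f x $ i\<bar> powr 2)"
    using f by (auto simp: L2_space3_def Lp_space_def)
  then have "(\<integral>x. \<bar>f x $ i\<bar> powr 2 \<partial>M) \<noteq> 0"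
    using i by (subst integral_nonneg_eq_0_iff_AE) auto
  then have "Lp_norm 2 M (\<lambda>x. f x $ i) \<noteq> 0"
    by (simp add: Lp_norm_def)
  then show ?thesis
    unfolding L2_norm3_def by (auto simp: vec_eq_iff)
qed

section \<open>The imaging operator\<close>

text \<open>
  Two signs cancel: the field moves with velocity \<open>- G v\<close>, and the law of induction contributes
  \<open>- \<mu>0\<close>.
\<close>

lemma system_function_eq_susceptibility:
  fixes xs :: "real \<Rightarrow> real ^ 3"
  assumes "\<beta> > 0" and G: "inj ((*v) G)" and ab: "a < b" and t: "t \<in> {a..b}"
    and xs: "xs differentiable (at t within {a..b})" and x: "x \<noteq> xs t"
  shows "system_function \<mu>0 m0 \<beta> G R {a..b} xs i x t
    = \<mu>0 * (R i \<bullet> susceptibility m0 \<beta> (G *v (x - xs t))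
        (G *v vector_derivative xs (at t within {a..b})))"
proof -
  let ?v = "vector_derivative xs (at t within {a..b})"
  have eq: "mean_moment m0 \<beta> G xs x = (\<lambda>s. magnetization m0 \<beta> (G *v (x - xs s)))"
    by (auto simp: fun_eq_iff mean_moment_def magnetization_def applied_field_def Let_def)
  have "(xs has_vector_derivative ?v) (at t within {a..b})"
    using xs by (simp add: vector_derivative_works)
  then have "((\<lambda>s. x - xs s) has_vector_derivative (0 - ?v)) (at t within {a..b})"
    by (intro derivative_intros)
  then have "((\<lambda>s. G *v (x - xs s)) has_vector_derivative G *v (0 - ?v)) (at t within {a..b})"
    by (rule bounded_linear.has_vector_derivative[OF matrix_vector_mul_bounded_linear])
  moreover have "G *v (x - xs t) \<noteq> 0"
    using x by (rule inj_matrix_vector_mult_diff_nonzero[OF G])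
  ultimately have "(mean_moment m0 \<beta> G xs x has_vector_derivative
      susceptibility m0 \<beta> (G *v (x - xs t)) (G *v (0 - ?v))) (at t within {a..b})"
    unfolding eq by (rule has_vector_derivative_magnetization[OF assms(1)])
  then have "vector_derivative (mean_moment m0 \<beta> G xs x) (at t within {a..b})
      = susceptibility m0 \<beta> (G *v (x - xs t)) (G *v (0 - ?v))"
    using vector_derivative_within_cbox[OF ab] t by simp
  moreover have "G *v (0 - ?v) = - (G *v ?v)"
    by (simp only: matrix_vector_mult_diff_distrib) simp
  moreover have "susceptibility m0 \<beta> y (- u) = - susceptibility m0 \<beta> y u" for y u :: "real ^ 3"
    by (simp add: susceptibility_def scaleR_right_distrib scaleR_right_diff_distrib)
  ultimately show ?thesis
    by (simp add: system_function_def)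
qed

text \<open>
  By the formula for \<open>x \<noteq> xs t\<close>, the two integrands agree off one point, which is enough
  both for measurability and for equality of the integrals.
\<close>

lemma
  fixes xs :: "real \<Rightarrow> real ^ 3"
  assumes "m0 > 0" "\<beta> > 0" and G: "inj ((*v) G)" and \<Omega>: "\<Omega> \<in> sets lebesgue"
    and c: "integrable (lebesgue_on \<Omega>) c"
    and ab: "a < b" and t: "t \<in> {a..b}" and xs: "xs differentiable (at t within {a..b})"
  shows integrable_system_function:
      "integrable (lebesgue_on \<Omega>) (\<lambda>x. c x * system_function \<mu>0 m0 \<beta> G R {a..b} xs i x t)" (is ?int)
    and integral_system_function:
      "(\<integral>x. c x * system_function \<mu>0 m0 \<beta> G R {a..b} xs i x t \<partial>lebesgue_on \<Omega>)
        = \<mu>0 * (R i \<bullet> response m0 \<beta> G \<Omega> c (xs t)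
            (G *v vector_derivative xs (at t within {a..b})))" (is ?integral)
proof -
  let ?s = "\<lambda>x. system_function \<mu>0 m0 \<beta> G R {a..b} xs i x t"
  let ?f = "\<lambda>x. c x *\<^sub>R susceptibility m0 \<beta> (G *v (x - xs t))
    (G *v vector_derivative xs (at t within {a..b}))"
  have f: "integrable (lebesgue_on \<Omega>) ?f"
    by (rule integrable_response) fact+
  then have int: "integrable (lebesgue_on \<Omega>) (\<lambda>x. \<mu>0 * (R i \<bullet> ?f x))"
    by (intro integrable_mult_right integrable_inner_right) auto
  have eq: "\<mu>0 * (R i \<bullet> ?f x) = c x * ?s x" if "x \<noteq> xs t" for x
    using system_function_eq_susceptibility[OF assms(2) G ab t xs that] by simp
  have ae: "AE x in lebesgue_on \<Omega>. \<mu>0 * (R i \<bullet> ?f x) = c x * ?s x"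
    using AE_lebesgue_on_neq[OF \<Omega>, of "xs t"] by (rule eventually_mono) (rule eq)
  have meas: "(\<lambda>x. c x * ?s x) \<in> borel_measurable (lebesgue_on \<Omega>)"
  proof (rule measurable_discrete_difference[where X = "{xs t} \<inter> \<Omega>"])
    show "(\<lambda>x. \<mu>0 * (R i \<bullet> ?f x)) \<in> borel_measurable (lebesgue_on \<Omega>)"
      using int by (rule borel_measurable_integrable)
    show "{x} \<in> sets (lebesgue_on \<Omega>)" if "x \<in> {xs t} \<inter> \<Omega>" for x
      using that \<Omega> by (auto simp: sets_restrict_space_iff)
    show "\<mu>0 * (R i \<bullet> ?f x) = c x * ?s x"
      if "x \<in> space (lebesgue_on \<Omega>)" "x \<notin> {xs t} \<inter> \<Omega>" for x
      using that by (intro eq) auto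
  qed auto
  show ?int
    by (rule integrable_cong_AE_imp[OF int meas]) (use ae in \<open>auto elim: eventually_mono\<close>)
  have "(\<integral>x. c x * ?s x \<partial>lebesgue_on \<Omega>) = (\<integral>x. \<mu>0 * (R i \<bullet> ?f x) \<partial>lebesgue_on \<Omega>)"
    by (rule integral_cong_AE[OF meas borel_measurable_integrable[OF int]])
       (use ae in \<open>auto elim: eventually_mono\<close>)
  also have "\<dots> = \<mu>0 * (\<integral>x. R i \<bullet> ?f x \<partial>lebesgue_on \<Omega>)"
    by (rule integral_mult_right_zero)
  also have "(\<integral>x. R i \<bullet> ?f x \<partial>lebesgue_on \<Omega>) = R i \<bullet> (\<integral>x. ?f x \<partial>lebesgue_on \<Omega>)"
    by (rule integral_inner_right) (use f in auto)
  finally show ?integral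
    unfolding response_def .
qed

theorem theorem2p10:
  fixes \<mu>0 m0 \<beta> T ts l :: real
    and I :: "real set"
    and \<Omega> :: "(real ^ 3) set"
    and G :: "real ^ 3 ^ 3"
    and R :: "3 \<Rightarrow> real ^ 3"
    and xs :: "real \<Rightarrow> real ^ 3"
  assumes "\<mu>0 > 0" and "m0 > 0" and "\<beta> > 0"
    and "I \<subseteq> {0..T}" and "is_interval I" and "compact I" and "emeasure lebesgue I \<noteq> 0"
    and "ts \<in> I"
    and "open \<Omega>" and "\<Omega> \<noteq> {}" and "connected \<Omega>" and "simply_connected \<Omega>" and "bounded \<Omega>"
    and "rank G = 3"
    and "span (range R) = UNIV"
    and "continuously_differentiable_on xs I"
    and "\<exists>tstar \<in> interior I. norm (vector_derivative xs (at tstar within I)) \<noteq> 0"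
    and "l > 1"
  defines "s \<equiv> system_function \<mu>0 m0 \<beta> G R I xs"
    and "A \<equiv> mpi_operator \<mu>0 m0 \<beta> G R I xs \<Omega>"
  shows "indicator \<Omega> \<in> Lp_space l (lebesgue_on \<Omega>) \<and>
    (\<forall>c \<in> Lp_space l (lebesgue_on \<Omega>).
       (\<forall>i. \<forall>t \<in> I. integrable (lebesgue_on \<Omega>) (\<lambda>x. c x * s i x t)) \<and>
       A c \<in> L2_space3 (lebesgue_on I)) \<and>
    L2_norm3 (lebesgue_on I) (A (indicator \<Omega>)) > 0 \<and>
    \<not> (AE t in lebesgue_on I. A (indicator \<Omega>) t = 0)"
proof -
  from assms(17) obtain tstar where
    tstar: "tstar \<in> interior I" "vector_derivative xs (at tstar within I) \<noteq> 0" by auto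
  obtain a b where I: "I = {a..b}"
    using \<open>is_interval I\<close> \<open>compact I\<close> is_interval_compact[of I] by auto
  have ab: "a < b"
    using tstar(1) unfolding I by simp
  have G: "inj ((*v) G)"
    using \<open>rank G = 3\<close> full_rank_injective[of G] by simp
  have lm: "\<Omega> \<in> lmeasurable"
    using \<open>open \<Omega>\<close> \<open>bounded \<Omega>\<close> lmeasurable_open by blast
  then have ms: "\<Omega> \<in> sets lebesgue" by auto
  have fin: "finite_measure (lebesgue_on \<Omega>)" by (rule finite_measure_lebesgue_on[OF lm])
  interpret finite_measure "lebesgue_on \<Omega>" by (rule fin)

  \<comment> \<open>The negative time derivative of the applied field, which does not depend on the position.\<close>
  define w where "w t = G *v vector_derivative xs (at t within I)" for t
  have w_cont: "continuous_on I w"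
    unfolding w_def using assms(16)
    by (intro bounded_linear.continuous_on[OF matrix_vector_mul_bounded_linear])
       (simp add: continuously_differentiable_on_def)
  have xs_diff: "xs differentiable (at t within I)" if "t \<in> I" for t
    using assms(16) that by (auto simp: continuously_differentiable_on_def differentiable_on_def)
  have xs_cont: "continuous_on I xs"
    using assms(16) by (auto simp: continuously_differentiable_on_def
        intro: differentiable_imp_continuous_on)

  have s_int: "integrable (lebesgue_on \<Omega>) (\<lambda>x. c x * s i x t)"
    and s_integral: "(\<integral>x. c x * s i x t \<partial>lebesgue_on \<Omega>)
      = \<mu>0 * (R i \<bullet> response m0 \<beta> G \<Omega> c (xs t) (w t))"
    if "integrable (lebesgue_on \<Omega>) c" "t \<in> I" for i t and c :: "real ^ 3 \<Rightarrow> real"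
    using integrable_system_function[OF \<open>m0 > 0\<close> \<open>\<beta> > 0\<close> G ms that(1) ab, of t xs \<mu>0 R i]
      integral_system_function[OF \<open>m0 > 0\<close> \<open>\<beta> > 0\<close> G ms that(1) ab, of t xs \<mu>0 R i]
      that(2) xs_diff[OF that(2)]
    by (simp_all add: I w_def s_def)
  have A_eq: "A c t = (\<chi> i. \<mu>0 * (R i \<bullet> response m0 \<beta> G \<Omega> c (xs t) (w t)))"
    if "integrable (lebesgue_on \<Omega>) c" "t \<in> I" for t and c :: "real ^ 3 \<Rightarrow> real"
    unfolding A_def mpi_operator_def using s_integral[OF that] by (simp add: s_def)
  have A_cont: "continuous_on I (A c)" if "integrable (lebesgue_on \<Omega>) c" for c
  proof (rule continuous_on_cong[THEN iffD1, OF refl])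
    show "(\<chi> i. \<mu>0 * (R i \<bullet> response m0 \<beta> G \<Omega> c (xs t) (w t))) = A c t" if "t \<in> I" for t
      using A_eq \<open>integrable (lebesgue_on \<Omega>) c\<close> that by simp
    show "continuous_on I (\<lambda>t. \<chi> i. \<mu>0 * (R i \<bullet> response m0 \<beta> G \<Omega> c (xs t) (w t)))"
      by (intro continuous_on_vec_lambda continuous_intros
          continuous_on_response[OF \<open>m0 > 0\<close> \<open>\<beta> > 0\<close> G ms that \<open>compact I\<close> xs_cont w_cont])
  qed
  have A_L2: "A c \<in> L2_space3 (lebesgue_on I)" if "integrable (lebesgue_on \<Omega>) c" for c
    using A_cont[OF that] unfolding I by (rule continuous_on_imp_L2_space3)

  have ind: "indicator \<Omega> \<in> Lp_space l (lebesgue_on \<Omega>)"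
  proof -
    have "integrable (lebesgue_on \<Omega>) (\<lambda>x. \<bar>indicator \<Omega> x :: real\<bar> powr l)"
      using integrable_const[of "1::real"]
      by (rule Bochner_Integration.integrable_cong[THEN iffD1, rotated -1]) auto
    moreover have "(indicator \<Omega> :: _ \<Rightarrow> real) \<in> borel_measurable (lebesgue_on \<Omega>)"
      using ms by (intro borel_measurable_indicator) (auto simp: sets_restrict_space)
    ultimately show ?thesis by (simp add: Lp_space_def)
  qed
  have c_int: "integrable (lebesgue_on \<Omega>) c" if "c \<in> Lp_space l (lebesgue_on \<Omega>)" for c
    using integrable_Lp_space[OF fin _ that] \<open>l > 1\<close> by simp
  note ind_int = c_int[OF ind]

  have "w tstar \<noteq> 0"
    using tstar(2) G unfolding w_def by (metis injD matrix_vector_mult_0_right)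
  then have V: "response m0 \<beta> G \<Omega> (indicator \<Omega>) (xs tstar) (w tstar) \<noteq> 0" (is "?V \<noteq> 0")
    using response_indicator_nonzero \<open>m0 > 0\<close> \<open>\<beta> > 0\<close> G \<open>open \<Omega>\<close> \<open>bounded \<Omega>\<close> \<open>\<Omega> \<noteq> {}\<close> by blast
  \<comment> \<open>A vector orthogonal to all coil sensitivities is orthogonal to itself.\<close>
  have A_nz: "A (indicator \<Omega>) tstar \<noteq> 0"
  proof
    assume "A (indicator \<Omega>) tstar = 0"
    then have RV: "R i \<bullet> ?V = 0" for i
      using A_eq[OF ind_int, of tstar] tstar(1) interior_subset[of I] \<open>\<mu>0 > 0\<close>
      by (auto simp: vec_eq_iff)
    have "orthogonal ?V ?V"
    proof (rule orthogonal_to_span)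
      show "?V \<in> span (range R)"
        by (simp add: \<open>span (range R) = UNIV\<close>)
      show "orthogonal ?V y" if "y \<in> range R" for y
        using that RV by (metis imageE inner_commute orthogonal_def)
    qed
    then show False using V by (simp add: orthogonal_def)
  qed
  have not_AE: "\<not> (AE t in lebesgue_on I. A (indicator \<Omega>) t = 0)"
    using continuous_AE_zero_on_interior[OF A_cont[OF ind_int] _ _ tstar(1)] A_nz
    unfolding I by auto
  show ?thesis
    using ind s_int A_L2 c_int not_AE L2_norm3_pos[OF A_L2[OF ind_int] not_AE] by blast
qed

end
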